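(* Let $G$ be a group of finite rank $n$ (i.e. the minimal cardinality of a generating set of $G$ is $n$). Then $F_0=2^n$, where $F_0=\min\{|F_S| : S\subseteq G,\ \chi_G\in F_S\}$ is the fusion number of the maximal element $\chi_G$ of $(A_G,\prec)$.
   Context: For a group $G$ and a subgroup $H$, let $\chi_H\colon G\to\{0,1\}$ be the characteristic function of $H$. Let $(A_G,\prec)$ be the set of characteristic functions of all subgroups of $G$, partially ordered by $\chi_H\prec\chi_K$ iff $H\subseteq K$; its maximal element is $\chi_G$. For $S\subseteq G$ and $f\in A_G$, $f$ is Occam on $S$ if $f$ is the least element (with respect to $\prec$) of $\{g\in A_G\mid g|_S=f|_S\}$. The fusion set $F_S$ is the set of all $f\in A_G$ that are Occam on $S$. The fusion number of $f\in A_G$ is $\min\{|F_S| : S\subseteq G,\ f\in F_S\}$ if finite, and $\infty$ otherwise. *)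

theory Defs
  imports "HOL-Algebra.Algebra" "HOL-Library.Extended_Nat" "HOL-Library.Indicator_Function"
begin

(* Library card sends every infinite set to 0. *)
definition ecard :: "'a set \<Rightarrow> enat" where
  "ecard A = (if finite A then enat (card A) else \<infinity>)"

(* A minimum of cardinalities, as an infimum in enat: it is attained for a nonempty family
   (enat is well-ordered), and carrier G itself generates G. Groups that are not finitely
   generated have rank \<infinity>. *)
definition group_rank :: "('a, 'b) monoid_scheme \<Rightarrow> enat" where
  "group_rank G = (INF S \<in> {S. S \<subseteq> carrier G \<and> generate G S = carrier G}. ecard S)"

(* Functions on the carrier are extensional (undefined outside it), so that equality of
   characteristic functions is equality as functions on the group. *)
definition chi :: "('a, 'b) monoid_scheme \<Rightarrow> 'a set \<Rightarrow> 'a \<Rightarrow> nat" where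
  "chi G H = restrict (indicator H) (carrier G)"

definition subgroup_chars :: "('a, 'b) monoid_scheme \<Rightarrow> ('a \<Rightarrow> nat) gorder" where
  "subgroup_chars G =
     \<lparr>carrier = {chi G H | H. subgroup H G},
      eq = (=),
      le = (\<lambda>f g. \<exists>H K. subgroup H G \<and> subgroup K G \<and> f = chi G H \<and> g = chi G K \<and> H \<subseteq> K)\<rparr>"

definition occam_on :: "('a, 'b) monoid_scheme \<Rightarrow> ('a \<Rightarrow> nat) \<Rightarrow> 'a set \<Rightarrow> bool" where
  "occam_on G f S \<longleftrightarrow>
     least (subgroup_chars G) f
       {g \<in> carrier (subgroup_chars G). restrict g S = restrict f S}"

definition fusion_set :: "('a, 'b) monoid_scheme \<Rightarrow> 'a set \<Rightarrow> ('a \<Rightarrow> nat) set" where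
  "fusion_set G S = {f \<in> carrier (subgroup_chars G). occam_on G f S}"

(* Again an attained infimum: chi G H lies in fusion_set G H for every subgroup H. *)
definition fusion_number :: "('a, 'b) monoid_scheme \<Rightarrow> ('a \<Rightarrow> nat) \<Rightarrow> enat" where
  "fusion_number G f =
     (INF S \<in> {S. S \<subseteq> carrier G \<and> f \<in> fusion_set G S}. ecard (fusion_set G S))"

lemma chi_eq_iff:
  assumes "subgroup H G" "subgroup K G"
  shows "chi G H = chi G K \<longleftrightarrow> H = K"
proof
  assume eq: "chi G H = chi G K"
  have "x \<in> H \<longleftrightarrow> x \<in> K" if "x \<in> carrier G" for x
    using fun_cong[OF eq, of x] that by (auto simp: chi_def indicator_def of_bool_def split: if_splits)
  then show "H = K"
    using assms[THEN subgroup.subset] by blast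
qed simp

lemma chi_le_iff:
  assumes "subgroup H G" "subgroup K G"
  shows "chi G H \<sqsubseteq>\<^bsub>subgroup_chars G\<^esub> chi G K \<longleftrightarrow> H \<subseteq> K"
  using assms chi_eq_iff[of _ G] by (auto simp: subgroup_chars_def)

end

theory Submission
  imports Defs
begin

text \<open>The function \<open>\<chi>\<^sub>H\<close> is Occam on \<open>S\<close> iff \<open>H\<close> is generated by \<open>H \<inter> S\<close>, so \<open>F\<^sub>S\<close>
  corresponds to the subgroups generated by subsets of \<open>S\<close>, and \<open>\<chi>\<^sub>G \<in> F\<^sub>S\<close> means that \<open>S\<close>
  generates \<open>G\<close>. A generating set of cardinality \<open>n\<close> gives at most \<open>2\<^sup>n\<close> such subgroups.
  Conversely, if \<open>G\<close> has finite rank, every generating set contains a finite irredundant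
  generating set \<open>T\<close>; distinct subsets of \<open>T\<close> generate distinct subgroups, and \<open>T\<close> has at
  least \<open>n\<close> elements.\<close>

section \<open>Occam functions and fusion sets in terms of generated subgroups\<close>

lemma restrict_chi_eq_iff:
  assumes "subgroup H G" "subgroup K G" "S \<subseteq> carrier G"
  shows "restrict (chi G H) S = restrict (chi G K) S \<longleftrightarrow> H \<inter> S = K \<inter> S"
proof
  assume eq: "restrict (chi G H) S = restrict (chi G K) S"
  have "x \<in> H \<longleftrightarrow> x \<in> K" if "x \<in> S" for x
    using fun_cong[OF eq, of x] that assms(3)
    by (auto simp: chi_def indicator_def of_bool_def split: if_splits)
  then show "H \<inter> S = K \<inter> S"
    by blast
next
  assume "H \<inter> S = K \<inter> S"
  then show "restrict (chi G H) S = restrict (chi G K) S"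
    using assms(3) by (auto simp: chi_def indicator_def fun_eq_iff restrict_def)
qed

lemma (in group) generate_subset_iff:
  assumes "S \<subseteq> carrier G" "subgroup H G"
  shows "generate G S \<subseteq> H \<longleftrightarrow> S \<subseteq> H"
  using assms generate_subgroup_incl[of S H] generate.incl[of _ S G] by blast

text \<open>Two characteristic functions agree on \<open>S\<close> exactly when the subgroups have
  the same trace on \<open>S\<close>. Every subgroup with the trace of \<open>H\<close> contains
  \<open>generate G (H \<inter> S)\<close>, and this subgroup, lying inside \<open>H\<close>, has
  that trace itself. So it is the least competitor.\<close>

lemma (in group) occam_on_chi_iff:
  assumes H: "subgroup H G" and S: "S \<subseteq> carrier G"
  shows "occam_on G (chi G H) S \<longleftrightarrow> H = generate G (H \<inter> S)"
proof -
  let ?K = "generate G (H \<inter> S)"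
  have K: "subgroup ?K G"
    using S by (intro generate_is_subgroup) auto
  have KH: "?K \<subseteq> H"
    using H S by (subst generate_subset_iff) auto
  have KS: "?K \<inter> S = H \<inter> S"
    using KH generate.incl[of _ "H \<inter> S" G] by blast
  have "occam_on G (chi G H) S \<longleftrightarrow> (\<forall>L. subgroup L G \<and> L \<inter> S = H \<inter> S \<longrightarrow> H \<subseteq> L)"
  proof -
    have "{g \<in> carrier (subgroup_chars G). restrict g S = restrict (chi G H) S}
      = {chi G L |L. subgroup L G \<and> L \<inter> S = H \<inter> S}" (is "?A = _")
      using restrict_chi_eq_iff[OF _ H S] by (auto simp: subgroup_chars_def)
    moreover have "?A \<subseteq> carrier (subgroup_chars G)"
      by blast
    ultimately have "least (subgroup_chars G) (chi G H) ?A \<longleftrightarrow>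
      (\<forall>L. subgroup L G \<and> L \<inter> S = H \<inter> S \<longrightarrow> chi G H \<sqsubseteq>\<^bsub>subgroup_chars G\<^esub> chi G L)"
      using H unfolding least_def Lower_def by (auto simp: subgroup_chars_def)
    then show ?thesis
      unfolding occam_on_def using chi_le_iff[OF H] by simp
  qed
  also have "\<dots> \<longleftrightarrow> H = ?K"
  proof
    assume "\<forall>L. subgroup L G \<and> L \<inter> S = H \<inter> S \<longrightarrow> H \<subseteq> L"
    \<comment> \<open>Take \<open>L = ?K\<close>, which is a competitor by
      \<open>KS\<close>.\<close>
    then show "H = ?K"
      using K KS KH by blast
  next
    assume eq: "H = ?K"
    show "\<forall>L. subgroup L G \<and> L \<inter> S = H \<inter> S \<longrightarrow> H \<subseteq> L"
    proof (intro allI impI)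
      fix L assume L: "subgroup L G \<and> L \<inter> S = H \<inter> S"
      then have "?K \<subseteq> L"
        using S by (subst generate_subset_iff) auto
      with eq show "H \<subseteq> L" by simp
    qed
  qed
  finally show ?thesis .
qed

text \<open>Indexing by all subsets \<open>T\<close> of \<open>S\<close>, not only by traces
  \<open>H \<inter> S\<close>, gives a domain of known size for counting. It adds no new subgroups:
  \<open>T\<close> lies in the trace of \<open>generate G T\<close> on \<open>S\<close>, so that
  trace already generates \<open>generate G T\<close>.\<close>

lemma (in group) fusion_set_eq:
  assumes S: "S \<subseteq> carrier G"
  shows "fusion_set G S = (\<lambda>T. chi G (generate G T)) ` Pow S"
proof
  show "fusion_set G S \<subseteq> (\<lambda>T. chi G (generate G T)) ` Pow S"
  proof
    fix f assume "f \<in> fusion_set G S"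
    then obtain H where H: "subgroup H G" "f = chi G H" "occam_on G (chi G H) S"
      by (auto simp: fusion_set_def subgroup_chars_def)
    then have "f = chi G (generate G (H \<inter> S))"
      using occam_on_chi_iff[OF H(1) S] by simp
    then show "f \<in> (\<lambda>T. chi G (generate G T)) ` Pow S"
      by blast
  qed
  show "(\<lambda>T. chi G (generate G T)) ` Pow S \<subseteq> fusion_set G S"
  proof clarify
    fix T assume T: "T \<subseteq> S"
    let ?H = "generate G T"
    have H: "subgroup ?H G"
      using T S by (intro generate_is_subgroup) auto
    have "T \<subseteq> ?H \<inter> S"
      using T by (auto intro: generate.incl)
    then have "?H \<subseteq> generate G (?H \<inter> S)"
      by (rule mono_generate)
    moreover have "generate G (?H \<inter> S) \<subseteq> ?H"
      using H S by (subst generate_subset_iff) auto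
    ultimately have "occam_on G (chi G ?H) S"
      using occam_on_chi_iff[OF H S] by blast
    then show "chi G ?H \<in> fusion_set G S"
      using H by (auto simp: fusion_set_def subgroup_chars_def)
  qed
qed

lemma (in group) chi_carrier_in_fusion_set_iff:
  assumes S: "S \<subseteq> carrier G"
  shows "chi G (carrier G) \<in> fusion_set G S \<longleftrightarrow> generate G S = carrier G"
proof -
  have "chi G (carrier G) \<in> fusion_set G S \<longleftrightarrow> occam_on G (chi G (carrier G)) S"
    using subgroup_self by (auto simp: fusion_set_def subgroup_chars_def)
  also have "\<dots> \<longleftrightarrow> carrier G = generate G (carrier G \<inter> S)"
    by (rule occam_on_chi_iff[OF subgroup_self S])
  finally show ?thesis
    using S by (auto simp: Int_absorb1)
qed

section \<open>Finite and irredundant generating sets\<close>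

lemma (in group) generate_finite_support:
  assumes "x \<in> generate G S"
  shows "\<exists>T. finite T \<and> T \<subseteq> S \<and> x \<in> generate G T"
  using assms
proof induction
  case one
  then show ?case
    using generate.one[of G "{}"] by blast
next
  case (incl h)
  then show ?case
    using generate.incl[of h "{h}" G] by blast
next
  case (inv h)
  then show ?case
    using generate.inv[of h "{h}" G] by blast
next
  case (eng h1 h2)
  then obtain T1 T2 where T: "finite T1" "T1 \<subseteq> S" "h1 \<in> generate G T1"
    "finite T2" "T2 \<subseteq> S" "h2 \<in> generate G T2"
    by blast
  have "h1 \<in> generate G (T1 \<union> T2)" "h2 \<in> generate G (T1 \<union> T2)"
    using T mono_generate[of T1 "T1 \<union> T2"] mono_generate[of T2 "T1 \<union> T2"] by auto
  then have "h1 \<otimes>\<^bsub>G\<^esub> h2 \<in> generate G (T1 \<union> T2)"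
    by (rule generate.eng)
  then show ?case
    using T by (meson finite_UnI Un_least)
qed

text \<open>Each of the finitely many elements of \<open>R\<close> is a word in finitely many
  elements of \<open>S\<close>. The union of these supports generates a subgroup containing
  \<open>R\<close>, hence all of \<open>G\<close>.\<close>

lemma (in group) generating_set_finite_subset:
  assumes R: "finite R" "generate G R = carrier G"
    and S: "S \<subseteq> carrier G" "generate G S = carrier G"
  shows "\<exists>T. finite T \<and> T \<subseteq> S \<and> generate G T = carrier G"
proof -
  have RG: "R \<subseteq> carrier G"
    using generate.incl[of _ R G] unfolding R(2) by (rule subsetI)
  then have "\<forall>r\<in>R. \<exists>T. finite T \<and> T \<subseteq> S \<and> r \<in> generate G T"
    using generate_finite_support[of _ S] unfolding S(2) by blast
  then obtain T where T: "\<And>r. r \<in> R \<Longrightarrow> finite (T r) \<and> T r \<subseteq> S \<and> r \<in> generate G (T r)"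
    by metis
  let ?U = "\<Union>r\<in>R. T r"
  have U: "finite ?U" "?U \<subseteq> S"
    using R(1) T by auto
  have "R \<subseteq> generate G ?U"
  proof
    fix r assume r: "r \<in> R"
    then have "generate G (T r) \<subseteq> generate G ?U"
      by (intro mono_generate) auto
    with T[OF r] show "r \<in> generate G ?U"
      by blast
  qed
  moreover have sub: "subgroup (generate G ?U) G"
    using U(2) S(1) by (intro generate_is_subgroup) auto
  ultimately have "carrier G \<subseteq> generate G ?U"
    using generate_subset_iff[OF RG sub] R(2) by simp
  then show ?thesis
    using U subgroup.subset[OF sub] by blast
qed

text \<open>If \<open>A\<close> and \<open>B\<close> generate the same subgroup and \<open>a\<close>
  lies in \<open>A\<close> but not in \<open>B\<close>, then \<open>B\<close> avoids
  \<open>a\<close>, so \<open>a\<close> is generated by \<open>T - {a}\<close>, against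
  irredundance.\<close>

lemma (in group) inj_on_generate_Pow:
  assumes irredundant: "\<And>t. t \<in> T \<Longrightarrow> t \<notin> generate G (T - {t})"
  shows "inj_on (generate G) (Pow T)"
proof -
  have le: "A \<subseteq> B" if "A \<subseteq> T" "B \<subseteq> T" "generate G A = generate G B" for A B
  proof
    fix a assume a: "a \<in> A"
    show "a \<in> B"
    proof (rule ccontr)
      assume "a \<notin> B"
      then have "generate G B \<subseteq> generate G (T - {a})"
        using that by (intro mono_generate) auto
      moreover have "a \<in> generate G B"
        using a generate.incl[of a A G] that(3) by simp
      ultimately show False
        using irredundant a that(1) by blast
    qed
  qed
  show ?thesis
    by (rule inj_onI) (use le in \<open>simp add: subset_antisym\<close>)
qed

text \<open>Discard an element generated by the others as long as there is one; finiteness makes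
  this stop. The additive group of rationals, by contrast, has no irredundant generating set at
  all.\<close>

lemma (in group) irredundant_generating_subset:
  assumes S: "finite S" "S \<subseteq> carrier G" "generate G S = carrier G"
  shows "\<exists>T \<subseteq> S. generate G T = carrier G \<and> (\<forall>t\<in>T. t \<notin> generate G (T - {t}))"
  using S
proof (induction S rule: finite_psubset_induct)
  case (psubset S)
  show ?case
  proof (cases "\<exists>t\<in>S. t \<in> generate G (S - {t})")
    case True
    then obtain t where t: "t \<in> S" "t \<in> generate G (S - {t})"
      by blast
    have sub: "subgroup (generate G (S - {t})) G"
      using psubset.prems(1) by (intro generate_is_subgroup) auto
    have "S \<subseteq> generate G (S - {t})"
      using t generate.incl[of _ "S - {t}" G] by blast
    then have "generate G (S - {t}) = carrier G"
      using generate_subset_iff[OF psubset.prems(1) sub] psubset.prems(2) subgroup.subset[OF sub]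
      by blast
    moreover have "S - {t} \<subset> S" "S - {t} \<subseteq> carrier G"
      using t(1) psubset.prems(1) by auto
    ultimately show ?thesis
      using psubset.IH[of "S - {t}"] by blast
  next
    case False
    then show ?thesis
      using psubset.prems by blast
  qed
qed

theorem theorem3p2:
  fixes G :: "('a, 'b) monoid_scheme" and n :: nat
  assumes "group G"
    and "group_rank G = enat n"
  shows "fusion_number G (chi G (carrier G)) = enat (2 ^ n)"
proof -
  interpret group G by fact
  let ?gens = "{S. S \<subseteq> carrier G \<and> generate G S = carrier G}"
  have fusion: "fusion_number G (chi G (carrier G)) = (INF S \<in> ?gens. ecard (fusion_set G S))"
    unfolding fusion_number_def
    by (rule INF_cong) (auto simp: chi_carrier_in_fusion_set_iff)
  \<comment> \<open>Since the family is nonempty, the infimum defining the rank is attained, which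
    yields the generating set \<open>R\<close>.\<close>
  have "carrier G \<in> ?gens"
    using generate_incl[of "carrier G"] generate.incl[of _ "carrier G" G] by auto
  then have "group_rank G \<in> ecard ` ?gens"
    unfolding group_rank_def by (intro wellorder_InfI) blast
  then obtain R where R: "R \<subseteq> carrier G" "generate G R = carrier G" "ecard R = enat n"
    using assms(2) by auto
  then have R_card: "finite R" "card R = n"
    by (auto simp: ecard_def split: if_splits)
  have rank_le: "n \<le> card T" if "T \<in> ?gens" "finite T" for T
  proof -
    have "group_rank G \<le> ecard T"
      unfolding group_rank_def using that(1) by (rule INF_lower)
    then show ?thesis
      using assms(2) that(2) by (simp add: ecard_def)
  qed
  show ?thesis
    unfolding fusion
  proof (rule antisym)
    \<comment> \<open>Upper bound: the fusion set of \<open>R\<close> is an image of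
      \<open>Pow R\<close>; coincidences among the generated subgroups only lower the count.\<close>
    have "finite (fusion_set G R)" "card (fusion_set G R) \<le> 2 ^ n"
      using R_card card_image_le[of "Pow R"] by (auto simp: fusion_set_eq[OF R(1)] card_Pow)
    then have "ecard (fusion_set G R) \<le> enat (2 ^ n)"
      by (simp add: ecard_def)
    then show "(INF S \<in> ?gens. ecard (fusion_set G S)) \<le> enat (2 ^ n)"
      using R by (intro INF_lower2[of R]) auto
  next
    show "enat (2 ^ n) \<le> (INF S \<in> ?gens. ecard (fusion_set G S))"
    proof (rule INF_greatest)
      fix S assume S: "S \<in> ?gens"
      then have SG: "S \<subseteq> carrier G" "generate G S = carrier G"
        by simp_all
      \<comment> \<open>Lower bound: distinct subsets of \<open>S\<close> may generate the same
        subgroup, so the count is made on a finite irredundant generating set \<open>T\<close>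
        inside \<open>S\<close>.\<close>
      obtain U where U: "finite U" "U \<subseteq> S" "generate G U = carrier G"
        using generating_set_finite_subset[OF R_card(1) R(2) SG] by metis
      have "U \<subseteq> carrier G"
        using U(2) SG(1) by (rule subset_trans)
      from irredundant_generating_subset[OF U(1) this U(3)]
      obtain T where T: "T \<subseteq> U" "generate G T = carrier G"
        "\<And>t. t \<in> T \<Longrightarrow> t \<notin> generate G (T - {t})"
        by metis
      have TG: "T \<subseteq> carrier G" and fin: "finite T"
        using T(1) U(1,2) SG(1) by (auto intro: finite_subset)
      have inj: "inj_on (\<lambda>A. chi G (generate G A)) (Pow T)"
      proof (rule inj_onI)
        fix A B assume AB: "A \<in> Pow T" "B \<in> Pow T"
          and eq: "chi G (generate G A) = chi G (generate G B)"
        have "subgroup (generate G A) G" "subgroup (generate G B) G"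
          using AB TG by (auto intro!: generate_is_subgroup)
        then have "generate G A = generate G B"
          using eq chi_eq_iff by blast
        then show "A = B"
          using inj_on_generate_Pow[OF T(3)] AB by (auto dest: inj_onD)
      qed
      have sub: "(\<lambda>A. chi G (generate G A)) ` Pow T \<subseteq> fusion_set G S"
        unfolding fusion_set_eq[OF SG(1)] using T(1) U(2) by (intro image_mono) auto
      \<comment> \<open>An infinite fusion set has \<open>ecard\<close> equal to
        \<open>\<infinity>\<close>, so only the finite case needs counting.\<close>
      have "2 ^ n \<le> card (fusion_set G S)" if "finite (fusion_set G S)"
      proof -
        have "(2::nat) ^ n \<le> 2 ^ card T"
          using rank_le[of T] TG T(2) fin by (intro power_increasing) auto
        also have "\<dots> = card ((\<lambda>A. chi G (generate G A)) ` Pow T)"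
          using card_image[OF inj] fin by (simp add: card_Pow)
        also have "\<dots> \<le> card (fusion_set G S)"
          using that sub by (rule card_mono)
        finally show ?thesis .
      qed
      then show "enat (2 ^ n) \<le> ecard (fusion_set G S)"
        by (simp add: ecard_def)
    qed
  qed
qed

end
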